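(* For every integer $n\geq1$, in the field $\mathbb Q(s_1,s_2,s_3)$, $$\frac{F_{2n+3}}{F_{2n+1}}=\left[g_n;\frac{-s_3}{g_{n-1}},\frac{-s_3}{g_{n-2}},\dots,\frac{-s_3}{g_1},\frac{-s_3}{g_0},\frac{-s_2}{s_1}\right].$$
   Context: The odd $*$-Fibonacci polynomials $F_{2n+1}\in\mathbb Z[s_1,s_2,s_3]$, $n\ge0$, are defined by $F_1=s_1$, $F_3=s_1^2-s_2$, and $F_{2n+3}=g_nF_{2n+1}-s_3F_{2n-1}$ for $n\ge1$, where $g_n=s_2$ if $n$ is odd and $g_n=s_1$ if $n$ is even. Continued fraction notation: $$\left[a_0;\frac{b_1}{a_1},\dots,\frac{b_m}{a_m}\right]=a_0+\cfrac{b_1}{a_1+\cfrac{b_2}{a_2+\cdots+\cfrac{b_m}{a_m}}}.$$ For example, for $n=1$ the right-hand side is $g_1-\dfrac{s_3}{g_0-\frac{s_2}{s_1}}$. *)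

theory Defs
  imports
    Complex_Main
    "HOL-Library.Poly_Mapping"
    "HOL-Library.Numeral_Type"
    "HOL-Computational_Algebra.Fraction_Field"
begin

text \<open>
  Polynomials are finitely supported maps from exponent vectors to coefficients. The three
  indeterminates are indexed by the three-element numeral type \<open>3\<close>, whose elements are
  \<open>1\<close>, \<open>2\<close> and \<open>3\<close> (the literal \<open>3\<close> denotes the same index as \<open>0\<close>).
\<close>

type_synonym spoly = "(3 \<Rightarrow>\<^sub>0 nat) \<Rightarrow>\<^sub>0 int"

definition s :: "3 \<Rightarrow> spoly" where
  "s i = Poly_Mapping.single (Poly_Mapping.single i 1) 1"

text \<open>The fraction field of \<open>\<int>[s\<^sub>1, s\<^sub>2, s\<^sub>3]\<close> is \<open>\<rat>(s\<^sub>1, s\<^sub>2, s\<^sub>3)\<close>.\<close>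

type_synonym sfield = "spoly fract"

definition emb :: "spoly \<Rightarrow> sfield" where
  "emb p = Fraction_Field.Fract p 1"

definition g :: "nat \<Rightarrow> spoly" where
  "g n = (if odd n then s 2 else s 1)"

text \<open>\<open>oddF n\<close> is the polynomial \<open>F\<^bsub>2n+1\<^esub>\<close>; its recurrence is that of
  \<open>F\<^bsub>2n+3\<^esub>\<close> with \<open>n\<close> replaced by \<open>n + 1\<close>.\<close>

fun oddF :: "nat \<Rightarrow> spoly" where
  "oddF 0 = s 1"
| "oddF (Suc 0) = (s 1)^2 - s 2"
| "oddF (Suc (Suc n)) = g (Suc n) * oddF (Suc n) - s 3 * oddF n"

text \<open>\<open>contfrac a\<^sub>0 [(b\<^sub>1, a\<^sub>1), \<dots>, (b\<^sub>m, a\<^sub>m)]\<close> is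
  \<open>[a\<^sub>0; b\<^sub>1/a\<^sub>1, \<dots>, b\<^sub>m/a\<^sub>m]\<close>.\<close>

fun contfrac :: "'a::field \<Rightarrow> ('a \<times> 'a) list \<Rightarrow> 'a" where
  "contfrac a [] = a"
| "contfrac a ((b, a') # bs) = a + b / contfrac a' bs"

text \<open>Since \<open>x / 0 = 0\<close> in HOL, \<open>contfrac\<close> always has a value; the following says that no
  division by zero occurs in it.\<close>

fun contfrac_defined :: "('a::field \<times> 'a) list \<Rightarrow> bool" where
  "contfrac_defined [] \<longleftrightarrow> True"
| "contfrac_defined ((b, a) # bs) \<longleftrightarrow> contfrac_defined bs \<and> contfrac a bs \<noteq> 0"

text \<open>The entries after \<open>g\<^sub>n\<close>: first
  \<open>(-s\<^sub>3, g\<^sub>j)\<close> for \<open>j = n - 1, \<dots>, 0\<close> in this (descending) order, then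
  \<open>(-s\<^sub>2, s\<^sub>1)\<close>.\<close>

definition cf_terms :: "nat \<Rightarrow> (sfield \<times> sfield) list" where
  "cf_terms n = map (\<lambda>j. (- emb (s 3), emb (g j))) (rev [0..<n]) @ [(- emb (s 2), emb (s 1))]"

end

theory Submission
  imports Defs
begin

text \<open>
  Dividing the recurrence by \<open>F\<^bsub>2n+3\<^esub>\<close> gives
  \<open>F\<^bsub>2n+5\<^esub> / F\<^bsub>2n+3\<^esub> = g\<^bsub>n+1\<^esub> - s\<^sub>3 / (F\<^bsub>2n+3\<^esub> / F\<^bsub>2n+1\<^esub>)\<close>, so each quotient
  is one step of a continued fraction whose tail is the preceding quotient. Unrolling ends at
  \<open>F\<^sub>3 / F\<^sub>1 = s\<^sub>1 - s\<^sub>2 / s\<^sub>1\<close>, where \<open>s\<^sub>1 = g\<^sub>0\<close>. The tails of the continued fraction are thus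
  \<open>s\<^sub>1\<close> and quotients of consecutive \<open>F\<close>'s, and everything is well defined as soon as no
  \<open>F\<^bsub>2n+1\<^esub>\<close> is the zero polynomial.

  Nonvanishing can be read off modulo \<open>s\<^sub>3\<close>: there the recurrence becomes
  \<open>F\<^bsub>2n+3\<^esub> = g\<^sub>n F\<^bsub>2n+1\<^esub>\<close> for \<open>n \<ge> 1\<close>, so a monomial free of \<open>s\<^sub>3\<close> that has coefficient \<open>1\<close> in \<open>F\<^bsub>2n+1\<^esub>\<close>
  yields, on multiplication by the indeterminate \<open>g\<^sub>n\<close>, such a monomial in \<open>F\<^bsub>2n+3\<^esub>\<close>
  (lemma \<open>oddF_coeff_one\<close>). The induction starts from \<open>s\<^sub>1\<close> in \<open>F\<^sub>1\<close> and \<open>s\<^sub>1\<^sup>2\<close> in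
  \<open>F\<^sub>3 = s\<^sub>1\<^sup>2 - s\<^sub>2\<close>.
\<close>

section \<open>Coefficients of a product with an indeterminate\<close>

lemma lookup_single_times_add:
  fixes p :: "'a::cancel_comm_monoid_add \<Rightarrow>\<^sub>0 'b::semiring_1"
  shows "Poly_Mapping.lookup (Poly_Mapping.single k 1 * p) (k + m) = Poly_Mapping.lookup p m"
  by (simp add: lookup_mult lookup_single when_mult)

lemma lookup_single_times_eq_0:
  fixes p :: "'a::monoid_add \<Rightarrow>\<^sub>0 'b::semiring_1"
  assumes "\<And>l. m \<noteq> k + l"
  shows "Poly_Mapping.lookup (Poly_Mapping.single k 1 * p) m = 0"
  using assms by (simp add: lookup_mult lookup_single when_mult)

lemma lookup_s_times_add:
  "Poly_Mapping.lookup (s i * p) (Poly_Mapping.single i 1 + m) = Poly_Mapping.lookup p m"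
  unfolding s_def by (rule lookup_single_times_add)

lemma lookup_s_times_eq_0:
  assumes "Poly_Mapping.lookup m i = 0"
  shows "Poly_Mapping.lookup (s i * p) m = 0"
  unfolding s_def
proof (rule lookup_single_times_eq_0)
  show "m \<noteq> Poly_Mapping.single i 1 + l" for l
    using assms by (auto simp: lookup_add)
qed

section \<open>The odd polynomials do not vanish\<close>

text \<open>
  The monomial produced for \<open>n \<ge> 1\<close> is \<open>g\<^bsub>n-1\<^esub> \<dots> g\<^sub>1 s\<^sub>1\<^sup>2\<close>. Freeness of \<open>s\<^sub>3\<close> is what
  keeps the term \<open>- s\<^sub>3 F\<^bsub>2n-1\<^esub>\<close> of the recurrence from contributing to the coefficient; it survives the
  step because every \<open>g\<^sub>n\<close> is \<open>s\<^sub>1\<close> or \<open>s\<^sub>2\<close>.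
\<close>

lemma oddF_coeff_one:
  "\<exists>m. Poly_Mapping.lookup m 3 = 0 \<and> Poly_Mapping.lookup (oddF n) m = 1"
proof (induction n rule: oddF.induct)
  case 1
  show ?case
    by (intro exI[of _ "Poly_Mapping.single 1 1"]) (simp add: s_def lookup_single)
next
  case 2
  have "Poly_Mapping.single 2 1 \<noteq> (Poly_Mapping.single 1 1 + Poly_Mapping.single 1 1 :: 3 \<Rightarrow>\<^sub>0 nat)"
  proof
    assume "Poly_Mapping.single 2 1 = (Poly_Mapping.single 1 1 + Poly_Mapping.single 1 1 :: 3 \<Rightarrow>\<^sub>0 nat)"
    from arg_cong[OF this, of "\<lambda>m. Poly_Mapping.lookup m 2"] show False
      by (simp add: lookup_add lookup_single)
  qed
  then show ?case
    by (intro exI[of _ "Poly_Mapping.single 1 1 + Poly_Mapping.single 1 1"])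
      (simp add: s_def power2_eq_square mult_single lookup_minus lookup_add lookup_single)
next
  case (3 n)
  then obtain m where m: "Poly_Mapping.lookup m 3 = 0" "Poly_Mapping.lookup (oddF (Suc n)) m = 1"
    by blast
  define i :: 3 where "i = (if odd (Suc n) then 2 else 1)"
  let ?m = "Poly_Mapping.single i 1 + m"
  have g: "g (Suc n) = s i"
    by (simp add: g_def i_def)
  have free: "Poly_Mapping.lookup ?m 3 = 0"
    using m(1) by (simp add: lookup_add lookup_single i_def)
  have "Poly_Mapping.lookup (oddF (Suc (Suc n))) ?m = 1"
    using m(2) lookup_s_times_add[of i "oddF (Suc n)" m] lookup_s_times_eq_0[OF free, of "oddF n"]
    by (simp add: g lookup_minus)
  with free show ?case by blast
qed

lemma oddF_nonzero: "oddF n \<noteq> 0"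
  using oddF_coeff_one[of n] by auto

section \<open>Quotients of consecutive odd polynomials\<close>

lemma emb_diff: "emb (p - q) = emb p - emb q"
  by (simp add: emb_def)

lemma emb_mult: "emb (p * q) = emb p * emb q"
  by (simp add: emb_def)

lemma emb_eq_0_iff: "emb p = 0 \<longleftrightarrow> p = 0"
  by (simp add: emb_def Zero_fract_def eq_fract)

lemma emb_oddF_nonzero: "emb (oddF n) \<noteq> 0"
  by (simp add: emb_eq_0_iff oddF_nonzero)

lemma cf_terms_Suc: "cf_terms (Suc n) = (- emb (s 3), emb (g n)) # cf_terms n"
  by (simp add: cf_terms_def)

text \<open>
  Definedness and value are proved together, since the divisor introduced in the step is the
  continued fraction for \<open>n\<close>, and it is nonzero because its value is a quotient of nonzero
  polynomials.
\<close>

lemma contfrac_cf_terms: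
  "contfrac_defined (cf_terms n) \<and>
    contfrac (emb (g n)) (cf_terms n) = emb (oddF (Suc n)) / emb (oddF n)"
proof (induction n)
  case 0
  have "emb (s 1) \<noteq> 0"
    using emb_oddF_nonzero[of 0] by simp
  then show ?case
    by (simp add: cf_terms_def g_def emb_diff emb_mult power2_eq_square field_simps)
next
  case (Suc n)
  then have "contfrac_defined (cf_terms n)"
    and tail: "contfrac (emb (g n)) (cf_terms n) = emb (oddF (Suc n)) / emb (oddF n)"
    by auto
  moreover have "emb (g (Suc n)) - emb (s 3) / (emb (oddF (Suc n)) / emb (oddF n)) =
      emb (oddF (Suc (Suc n))) / emb (oddF (Suc n))"
    using emb_oddF_nonzero[of "Suc n"] by (simp add: emb_diff emb_mult diff_divide_distrib)
  ultimately show ?case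
    using emb_oddF_nonzero[of n] emb_oddF_nonzero[of "Suc n"]
    by (simp add: cf_terms_Suc tail del: oddF.simps)
qed

theorem theorem8p17:
  fixes n :: nat
  assumes "n \<ge> 1"
  shows "emb (oddF n) \<noteq> 0 \<and> contfrac_defined (cf_terms n) \<and>
    emb (oddF (n + 1)) / emb (oddF n) = contfrac (emb (g n)) (cf_terms n)"
  using emb_oddF_nonzero[of n] contfrac_cf_terms[of n] by simp

end
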